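(* Let $X\neq\emptyset$ be a set and let $1<p<\infty$. Then any $p$-resistance form $\mathcal E\colon\mathcal F(X)\to[0,\infty]$ is a nonlinear resistance form.
   Context: $\mathcal F(X)$ is the real vector space of all functions $f\colon X\to\mathbb R$, equipped with the topology of pointwise convergence; $D(\mathcal E)=\{f\mid\mathcal E(f)<\infty\}$, $\ker\mathcal E=\{f\mid\mathcal E(f)=0\}$, and $\mathbb R\cdot1$ denotes the constant functions. The elementary resistance is $R(x,y)=\sup\{f(x)-f(y)\mid\mathcal E(f)\le1\}$, $x,y\in X$. Nonlinear resistance form: a functional $\mathcal E\colon\mathcal F(X)\to[0,\infty]$ such that (1) $\mathcal E$ is convex with $\mathcal E(0)=0$; (2) $\mathcal E$ is lower semicontinuous with respect to pointwise convergence, i.e. $\mathcal E(f)\le\liminf_i\mathcal E(f_i)$ for every net $f_i\to f$ pointwise; (3) $R(x,y)<\infty$ for all $x,y\in X$; (4) all normal contractions operate on $\mathcal E$, i.e. for every $1$-Lipschitz $C\colon\mathbb R\to\mathbb R$ with $C(0)=0$ and all $f,g\in\mathcal F(X)$, $\mathcal E(f+C\circ g)+\mathcal E(f-C\circ g)\le\mathcal E(f+g)+\mathcal E(f-g)$. Generalized $p$-contraction property: let $|\cdot|_q$ be the $\ell^q$-norm on $\mathbb R^d$, $1\le q\le\infty$, and for $f=(f_1,\dots,f_d)\in D(\mathcal E)^d$ write $\mathcal E^{1/p}(f)=(\mathcal E(f_1)^{1/p},\dots,\mathcal E(f_d)^{1/p})\in\mathbb R^d$. $\mathcal E$ has the generalized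 $p$-contraction property if for all $1\le q_1\le p\le q_2\le\infty$, all $d_1,d_2\in\mathbb N$, all $T\colon\mathbb R^{d_1}\to\mathbb R^{d_2}$ with $T(0)=0$ and $|T(x)-T(y)|_{q_2}\le|x-y|_{q_1}$ for all $x,y\in\mathbb R^{d_1}$, and all $f\in D(\mathcal E)^{d_1}$, we have $T(f)\in D(\mathcal E)^{d_2}$ and $|\mathcal E^{1/p}(T(f))|_{q_2}\le|\mathcal E^{1/p}(f)|_{q_1}$ (where $T(f)$ is formed pointwise on $X$). $p$-resistance form (in the sense of Kajino and Shimizu), $1<p<\infty$: a functional $\mathcal E\colon\mathcal F(X)\to[0,\infty]$ such that (a) $\ker\mathcal E=\mathbb R\cdot1$ and $\mathcal E^{1/p}$ is a seminorm on the vector space $D(\mathcal E)$; (b) the quotient space $(D(\mathcal E)/\mathbb R\cdot1,\mathcal E^{1/p})$ is a Banach space; (c) for all $x,y\in X$ with $x\neq y$ there exists $f\in D(\mathcal E)$ with $f(x)\neq f(y)$; (d) $R(x,y)<\infty$ for all $x,y\in X$; (e) $\mathcal E$ satisfies the generalized $p$-contraction property. *)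

theory Defs
  imports
    "HOL-Analysis.Analysis"
    "HOL-Library.Function_Algebras"
    "HOL-Algebra.Group"
begin

text \<open>
  The set \<open>X\<close> is a type \<open>'a\<close>, which is nonempty as every type in HOL. A functional on the
  space of all real functions on \<open>X\<close> is a map \<open>('a \<Rightarrow> real) \<Rightarrow> ennreal\<close>. Sums and differences
  of functions are pointwise.
\<close>

subsection \<open>Functionals and nonlinear resistance forms\<close>

definition energy_domain :: "(('a \<Rightarrow> real) \<Rightarrow> ennreal) \<Rightarrow> ('a \<Rightarrow> real) set" where
  "energy_domain E = {f. E f < \<infinity>}"

definition energy_kernel :: "(('a \<Rightarrow> real) \<Rightarrow> ennreal) \<Rightarrow> ('a \<Rightarrow> real) set" where
  "energy_kernel E = {f. E f = 0}"

definition const_funs :: "('a \<Rightarrow> real) set" where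
  "const_funs = range (\<lambda>c. \<lambda>_. c)"

definition resistance :: "(('a \<Rightarrow> real) \<Rightarrow> ennreal) \<Rightarrow> 'a \<Rightarrow> 'a \<Rightarrow> ereal" where
  "resistance E x y = (SUP f\<in>{f. E f \<le> 1}. ereal (f x - f y))"

text \<open>In \<open>ennreal\<close> we have \<open>0 * \<infinity> = 0\<close>, so the cases \<open>t = 0\<close> and \<open>t = 1\<close> impose nothing.\<close>

definition convex_functional :: "(('a \<Rightarrow> real) \<Rightarrow> ennreal) \<Rightarrow> bool" where
  "convex_functional E \<longleftrightarrow>
     (\<forall>f g. \<forall>t::real. 0 \<le> t \<and> t \<le> 1 \<longrightarrow>
        E (\<lambda>x. (1 - t) * f x + t * g x) \<le> ennreal (1 - t) * E f + ennreal t * E g)"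

text \<open>
  A definition cannot quantify over the index types of nets, so nets are represented by filters
  on the function space itself. The lemma \<open>lsc_pointwise_net\<close> recovers arbitrary index types.
\<close>

definition lsc_pointwise :: "(('a \<Rightarrow> real) \<Rightarrow> ennreal) \<Rightarrow> bool" where
  "lsc_pointwise E \<longleftrightarrow>
     (\<forall>F f. (\<forall>x. ((\<lambda>g. g x) \<longlongrightarrow> f x) F) \<longrightarrow> E f \<le> Liminf F E)"

lemma lsc_pointwise_net:
  assumes "lsc_pointwise E" and "\<And>x. ((\<lambda>i. \<phi> i x) \<longlongrightarrow> f x) I"
  shows "E f \<le> Liminf I (\<lambda>i. E (\<phi> i))"
proof -
  have "\<forall>x. ((\<lambda>g. g x) \<longlongrightarrow> f x) (filtermap \<phi> I)"
    using assms(2) by (simp add: filterlim_filtermap)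
  then have "E f \<le> Liminf (filtermap \<phi> I) E"
    using assms(1) unfolding lsc_pointwise_def by blast
  also have "Liminf (filtermap \<phi> I) E \<le> Liminf I (\<lambda>i. E (\<phi> i))"
    unfolding Liminf_def
  proof (rule SUP_least)
    fix P assume "P \<in> {P. eventually P (filtermap \<phi> I)}"
    then have "eventually (\<lambda>i. P (\<phi> i)) I"
      by (simp add: eventually_filtermap)
    moreover have "Inf (E ` Collect P) \<le> (INF i\<in>{i. P (\<phi> i)}. E (\<phi> i))"
      by (rule INF_greatest) (auto intro: INF_lower)
    ultimately show "Inf (E ` Collect P) \<le>
        (SUP Q\<in>{Q. eventually Q I}. INF i\<in>Collect Q. E (\<phi> i))"
      by (auto intro: SUP_upper2)
  qed
  finally show ?thesis .
qed

definition normal_contractions_operate :: "(('a \<Rightarrow> real) \<Rightarrow> ennreal) \<Rightarrow> bool" where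
  "normal_contractions_operate E \<longleftrightarrow>
     (\<forall>C :: real \<Rightarrow> real. 1-lipschitz_on UNIV C \<and> C 0 = 0 \<longrightarrow>
        (\<forall>f g. E (f + (C \<circ> g)) + E (f - (C \<circ> g)) \<le> E (f + g) + E (f - g)))"

definition nonlinear_resistance_form :: "(('a \<Rightarrow> real) \<Rightarrow> ennreal) \<Rightarrow> bool" where
  "nonlinear_resistance_form E \<longleftrightarrow>
     convex_functional E \<and> E 0 = 0 \<and>
     lsc_pointwise E \<and>
     (\<forall>x y. resistance E x y < \<infinity>) \<and>
     normal_contractions_operate E"

subsection \<open>The generalized p-contraction property\<close>

text \<open>
  Vectors of dimension \<open>d \<ge> 1\<close> are functions \<open>nat \<Rightarrow> real\<close> of which only the entries with index
  below \<open>d\<close> are relevant.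
\<close>

definition lq_norm :: "ereal \<Rightarrow> nat \<Rightarrow> (nat \<Rightarrow> real) \<Rightarrow> real" where
  "lq_norm q d v =
     (if q = \<infinity> then Max ((\<lambda>i. \<bar>v i\<bar>) ` {..<d})
      else (\<Sum>i<d. \<bar>v i\<bar> powr real_of_ereal q) powr (1 / real_of_ereal q))"

text \<open>Only meaningful on \<open>energy_domain E\<close>, because \<open>enn2real \<infinity> = 0\<close>.\<close>

definition energy_root :: "real \<Rightarrow> (('a \<Rightarrow> real) \<Rightarrow> ennreal) \<Rightarrow> ('a \<Rightarrow> real) \<Rightarrow> real" where
  "energy_root p E f = enn2real (E f) powr (1 / p)"

text \<open>
  The Lipschitz condition forces the first \<open>d2\<close> entries of \<open>T x\<close> to depend only on the first
  \<open>d1\<close> entries of \<open>x\<close>, so \<open>T\<close> ranges over the maps from dimension \<open>d1\<close> to dimension \<open>d2\<close>.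
\<close>

definition generalized_contraction_property ::
    "real \<Rightarrow> (('a \<Rightarrow> real) \<Rightarrow> ennreal) \<Rightarrow> bool" where
  "generalized_contraction_property p E \<longleftrightarrow>
     (\<forall>(q1::ereal) (q2::ereal) (d1::nat) (d2::nat) (T :: (nat \<Rightarrow> real) \<Rightarrow> nat \<Rightarrow> real)
        (f :: nat \<Rightarrow> 'a \<Rightarrow> real).
        1 \<le> q1 \<and> q1 \<le> ereal p \<and> ereal p \<le> q2 \<and> q2 \<le> \<infinity> \<and> 1 \<le> d1 \<and> 1 \<le> d2 \<and>
        (\<forall>j<d2. T (\<lambda>_. 0) j = 0) \<and>
        (\<forall>x y. lq_norm q2 d2 (T x - T y) \<le> lq_norm q1 d1 (x - y)) \<and>
        (\<forall>i<d1. f i \<in> energy_domain E) \<longrightarrow>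
          (\<forall>j<d2. (\<lambda>x. T (\<lambda>i. f i x) j) \<in> energy_domain E) \<and>
          lq_norm q2 d2 (\<lambda>j. energy_root p E (\<lambda>x. T (\<lambda>i. f i x) j))
            \<le> lq_norm q1 d1 (\<lambda>i. energy_root p E (f i)))"

subsection \<open>Seminorms, quotients and Banach spaces\<close>

definition seminorm_on :: "('a \<Rightarrow> real) set \<Rightarrow> (('a \<Rightarrow> real) \<Rightarrow> real) \<Rightarrow> bool" where
  "seminorm_on V N \<longleftrightarrow>
     0 \<in> V \<and> (\<forall>f\<in>V. \<forall>g\<in>V. f + g \<in> V) \<and> (\<forall>a. \<forall>f\<in>V. (\<lambda>x. a * f x) \<in> V) \<and>
     (\<forall>f\<in>V. 0 \<le> N f) \<and>
     (\<forall>a. \<forall>f\<in>V. N (\<lambda>x. a * f x) = \<bar>a\<bar> * N f) \<and>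
     (\<forall>f\<in>V. \<forall>g\<in>V. N (f + g) \<le> N f + N g)"

text \<open>
  A real Banach space with explicit carrier \<open>V\<close>. The metric is cut off outside \<open>V\<close> because the
  locale \<open>Metric_space\<close> demands symmetry and nonnegativity on the whole type.
\<close>

definition banach_space_on ::
    "'v set \<Rightarrow> ('v \<Rightarrow> 'v \<Rightarrow> 'v) \<Rightarrow> 'v \<Rightarrow> (real \<Rightarrow> 'v \<Rightarrow> 'v) \<Rightarrow> ('v \<Rightarrow> real) \<Rightarrow> bool" where
  "banach_space_on V add zer scl nrm \<longleftrightarrow>
     comm_group \<lparr>carrier = V, mult = add, one = zer\<rparr> \<and>
     (\<forall>a. \<forall>u\<in>V. scl a u \<in> V) \<and>
     (\<forall>a. \<forall>u\<in>V. \<forall>v\<in>V. scl a (add u v) = add (scl a u) (scl a v)) \<and>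
     (\<forall>a b. \<forall>u\<in>V. scl (a + b) u = add (scl a u) (scl b u)) \<and>
     (\<forall>a b. \<forall>u\<in>V. scl a (scl b u) = scl (a * b) u) \<and>
     (\<forall>u\<in>V. scl 1 u = u) \<and>
     (\<forall>u\<in>V. 0 \<le> nrm u) \<and>
     (\<forall>u\<in>V. nrm u = 0 \<longleftrightarrow> u = zer) \<and>
     (\<forall>a. \<forall>u\<in>V. nrm (scl a u) = \<bar>a\<bar> * nrm u) \<and>
     (\<forall>u\<in>V. \<forall>v\<in>V. nrm (add u v) \<le> nrm u + nrm v) \<and>
     Metric_space.mcomplete V
       (\<lambda>u v. if u \<in> V \<and> v \<in> V then nrm (add u (scl (- 1) v)) else 0)"

text \<open>The quotient of a space of functions by the constants; elements are cosets.\<close>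

definition const_coset :: "('a \<Rightarrow> real) \<Rightarrow> ('a \<Rightarrow> real) set" where
  "const_coset f = {f + k | k. k \<in> const_funs}"

definition coset_add :: "('a \<Rightarrow> real) set \<Rightarrow> ('a \<Rightarrow> real) set \<Rightarrow> ('a \<Rightarrow> real) set" where
  "coset_add A B = {f + g | f g. f \<in> A \<and> g \<in> B}"

text \<open>The summand \<open>k\<close> matters only for \<open>a = 0\<close>, where the result must be the zero coset.\<close>

definition coset_scale :: "real \<Rightarrow> ('a \<Rightarrow> real) set \<Rightarrow> ('a \<Rightarrow> real) set" where
  "coset_scale a A = {(\<lambda>x. a * f x) + k | f k. f \<in> A \<and> k \<in> const_funs}"

definition quotient_norm :: "(('a \<Rightarrow> real) \<Rightarrow> real) \<Rightarrow> ('a \<Rightarrow> real) set \<Rightarrow> real" where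
  "quotient_norm N A = (INF f\<in>A. N f)"

definition p_resistance_form :: "real \<Rightarrow> (('a \<Rightarrow> real) \<Rightarrow> ennreal) \<Rightarrow> bool" where
  "p_resistance_form p E \<longleftrightarrow>
     energy_kernel E = const_funs \<and>
     seminorm_on (energy_domain E) (energy_root p E) \<and>
     banach_space_on (const_coset ` energy_domain E) coset_add (const_coset 0) coset_scale
       (quotient_norm (energy_root p E)) \<and>
     (\<forall>x y. x \<noteq> y \<longrightarrow> (\<exists>f\<in>energy_domain E. f x \<noteq> f y)) \<and>
     (\<forall>x y. resistance E x y < \<infinity>) \<and>
     generalized_contraction_property p E"

end

theory Submission
  imports Defs
begin

text \<open>
  Only lower semicontinuity needs completeness. A two-point inequality (Clarkson's for \<open>p \<ge> 2\<close>, the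
  hypercontractive one for \<open>p \<le> 2\<close>), fed into the contraction property as a linear map of the plane,
  makes \<open>E\<^sup>1\<^sup>/\<^sup>p\<close> uniformly convex. Given \<open>f\<close>, let \<open>M\<close> be the least level such that every
  basic neighbourhood of \<open>f\<close> in the pointwise topology contains, for each \<open>\<delta> > 0\<close>, a function of
  energy root at most \<open>M + \<delta>\<close>. Neighbourhoods are convex, so by uniform convexity the almost
  minimal elements of small enough neighbourhoods are close to each other in energy. A sequence of
  them converges in energy, and the resistance estimate shows that the limit is \<open>f\<close> up to a
  constant. Hence sublevel sets are closed, without any appeal to weak compactness. Contractions
  operate because \<open>|a + c|\<^sup>p + |a - c|\<^sup>p\<close> is increasing in \<open>|c|\<close>.
\<close>

section \<open>Two-point inequalities\<close>

text \<open>For positive arguments this is convexity of the power on the open half-line. A vanishing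
  argument reduces it to \<open>s powr p \<le> s\<close> for \<open>s\<close> in the unit
  interval.\<close>

lemma powr_convex_nonneg:
  fixes p x y t :: real
  assumes "1 \<le> p" "0 \<le> t" "t \<le> 1" "0 \<le> x" "0 \<le> y"
  shows "((1 - t) * x + t * y) powr p \<le> (1 - t) * x powr p + t * y powr p"
proof -
  have scale: "(s * z) powr p \<le> s * z powr p" if "0 \<le> s" "s \<le> 1" "0 \<le> z" for s z :: real
  proof (cases "s = 0")
    case False
    then have "s powr p \<le> s"
      using that assms(1) powr_mono'[of 1 p s] by simp
    then show ?thesis
      using that by (simp add: powr_mult mult_right_mono)
  qed simp
  consider "x = 0" | "y = 0" | "0 < x" "0 < y"
    using assms by linarith
  then show ?thesis
  proof cases
    case 3
    then show ?thesis
      using convex_onD[OF powr_convex, of p t x y] assms by simp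
  qed (use scale[of t y] scale[of "1 - t" x] assms in auto)
qed

lemma abs_powr_convex:
  fixes p x y t :: real
  assumes "1 < p" "0 \<le> t" "t \<le> 1"
  shows "\<bar>(1 - t) * x + t * y\<bar> powr p \<le> (1 - t) * \<bar>x\<bar> powr p + t * \<bar>y\<bar> powr p"
proof -
  have "\<bar>(1 - t) * x + t * y\<bar> \<le> (1 - t) * \<bar>x\<bar> + t * \<bar>y\<bar>"
    using assms abs_triangle_ineq[of "(1 - t) * x" "t * y"] by (simp add: abs_mult)
  then have "\<bar>(1 - t) * x + t * y\<bar> powr p \<le> ((1 - t) * \<bar>x\<bar> + t * \<bar>y\<bar>) powr p"
    using assms by (intro powr_mono2) auto
  also have "\<dots> \<le> (1 - t) * \<bar>x\<bar> powr p + t * \<bar>y\<bar> powr p"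
    using assms by (intro powr_convex_nonneg) auto
  finally show ?thesis .
qed

text \<open>Both \<open>a + c\<close> and \<open>a - c\<close> are convex combinations of
  \<open>a + b\<close> and \<open>a - b\<close>, with the two weights exchanged. Adding the two
  convexity estimates makes the weights sum to one.\<close>

lemma powr_sum_diff_mono:
  fixes p a b c :: real
  assumes "1 < p" "\<bar>c\<bar> \<le> \<bar>b\<bar>"
  shows "\<bar>a + c\<bar> powr p + \<bar>a - c\<bar> powr p \<le> \<bar>a + b\<bar> powr p + \<bar>a - b\<bar> powr p"
proof (cases "b = 0")
  case True
  then show ?thesis using assms by simp
next
  case False
  define r t where "r = c / b" and "t = (1 + r) / 2"
  have "\<bar>r\<bar> \<le> 1" using assms False by (simp add: r_def)
  then have "- 1 \<le> r" "r \<le> 1" by linarith+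
  then have t: "0 \<le> t" "t \<le> 1" by (simp_all add: t_def)
  have "2 * t - 1 = r" by (simp add: t_def field_simps)
  then have c: "c = (2 * t - 1) * b" using False by (simp add: r_def)
  have plus: "a + c = (1 - t) * (a - b) + t * (a + b)"
    and minus: "a - c = (1 - t) * (a + b) + t * (a - b)"
    unfolding c by (simp_all add: algebra_simps)
  have "\<bar>a + c\<bar> powr p \<le> (1 - t) * \<bar>a - b\<bar> powr p + t * \<bar>a + b\<bar> powr p"
    using abs_powr_convex[OF assms(1) t, of "a - b" "a + b"] by (simp only: plus)
  moreover have "\<bar>a - c\<bar> powr p \<le> (1 - t) * \<bar>a + b\<bar> powr p + t * \<bar>a - b\<bar> powr p"
    using abs_powr_convex[OF assms(1) t, of "a + b" "a - b"] by (simp only: minus)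
  ultimately show ?thesis by (simp add: algebra_simps)
qed

text \<open>Write \<open>z powr r\<close> as \<open>z\<close> times \<open>z powr (r - 1)\<close>
  and enlarge the second factor to \<open>(x + y) powr (r - 1)\<close>.\<close>

lemma powr_sum_le_powr:
  fixes x y r :: real
  assumes "0 \<le> x" "0 \<le> y" "1 \<le> r"
  shows "x powr r + y powr r \<le> (x + y) powr r"
proof -
  have *: "z powr r \<le> z * (x + y) powr (r - 1)" if "0 \<le> z" "z \<le> x + y" for z
  proof (cases "z = 0")
    case False
    then have "z powr r = z * z powr (r - 1)"
      using that by (simp add: powr_diff)
    then show ?thesis using that assms by (auto intro!: mult_left_mono powr_mono2)
  qed (use assms in auto)
  have "x powr r + y powr r \<le> (x + y) * (x + y) powr (r - 1)"
    using *[of x] *[of y] assms by (simp add: algebra_simps)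
  also have "\<dots> = (x + y) powr r"
    using assms by (cases "x + y = 0") (auto simp: powr_diff)
  finally show ?thesis .
qed

lemma square_powr_half:
  fixes z p :: real
  shows "(z\<^sup>2) powr (p / 2) = \<bar>z\<bar> powr p"
proof (cases "z = 0")
  case False
  then have "z\<^sup>2 = \<bar>z\<bar> powr 2" by simp
  then show ?thesis by (simp only: powr_powr) simp
qed simp

text \<open>With exponent \<open>p / 2\<close>, which is at least 1, apply superadditivity to the
  squares, then the parallelogram identity, then convexity.\<close>

lemma two_point_clarkson:
  fixes a b p :: real
  assumes "2 \<le> p"
  shows "\<bar>a\<bar> powr p + \<bar>b\<bar> powr p \<le> (\<bar>a + b\<bar> powr p + \<bar>a - b\<bar> powr p) / 2"
proof -
  have "\<bar>a\<bar> powr p + \<bar>b\<bar> powr p \<le> (a\<^sup>2 + b\<^sup>2) powr (p / 2)"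
    using powr_sum_le_powr[of "a\<^sup>2" "b\<^sup>2" "p / 2"] assms by (simp add: square_powr_half)
  also have "a\<^sup>2 + b\<^sup>2 = (1 - 1/2) * (a + b)\<^sup>2 + (1/2) * (a - b)\<^sup>2"
    by (simp add: power2_eq_square algebra_simps)
  also have "\<dots> powr (p / 2) \<le> (1 - 1/2) * ((a + b)\<^sup>2) powr (p/2) + (1/2) * ((a - b)\<^sup>2) powr (p/2)"
    using assms by (intro powr_convex_nonneg) auto
  also have "\<dots> = (\<bar>a + b\<bar> powr p + \<bar>a - b\<bar> powr p) / 2"
    by (simp add: square_powr_half)
  finally show ?thesis .
qed

text \<open>The difference \<open>h\<close> of the two sides vanishes at 0 together with its
  derivative \<open>h1\<close>, and its second derivative \<open>h2\<close> is nonnegative.\<close>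

lemma powr_second_order_bound:
  fixes t p :: real
  assumes "1 < p" "p \<le> 2" "0 \<le> t" "t \<le> 1"
  shows "2 + p * (p - 1) * t\<^sup>2 \<le> (1 + t) powr p + (1 - t) powr p"
proof -
  define h where "h = (\<lambda>t. (1 + t) powr p + (1 - t) powr p - 2 - p * (p - 1) * t\<^sup>2)"
  define h1 where "h1 = (\<lambda>t. p * ((1 + t) powr (p - 1) - (1 - t) powr (p - 1) - 2 * (p - 1) * t))"
  define h2 where "h2 = (\<lambda>t. p * (p - 1) * ((1 + t) powr (p - 2) + (1 - t) powr (p - 2) - 2))"
  have h1: "(h has_real_derivative h1 u) (at u)" if "0 \<le> u" "u < 1" for u
    unfolding h_def h1_def using that
    by (auto intro!: derivative_eq_intros simp: algebra_simps powr_diff)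
  have h2: "(h1 has_real_derivative h2 u) (at u)" if "0 \<le> u" "u < 1" for u
    unfolding h1_def h2_def using that
    by (auto intro!: derivative_eq_intros simp: algebra_simps)
  have h2_nonneg: "0 \<le> h2 u" if "0 \<le> u" "u < 1" for u
  proof -
    \<comment> \<open>\<open>A * B\<close> is a power of \<open>1 - u\<^sup>2\<close> with
      nonpositive exponent, hence at least 1; then the sum of the squares is at least
      \<open>2 * A * B\<close>.\<close>
    define A B where "A = (1 + u) powr ((p - 2) / 2)" and "B = (1 - u) powr ((p - 2) / 2)"
    have sq: "(1 + u) powr (p - 2) = A\<^sup>2" "(1 - u) powr (p - 2) = B\<^sup>2"
      by (simp_all add: A_def B_def power2_eq_square flip: powr_add)
    have "A * B = (1 - u\<^sup>2) powr ((p - 2) / 2)"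
      using that by (simp add: A_def B_def flip: powr_mult) (simp add: power2_eq_square algebra_simps)
    moreover have "0 < 1 - u\<^sup>2" "1 - u\<^sup>2 \<le> 1"
      using that power_strict_mono[of u 1 2] by auto
    ultimately have "1 \<le> A * B"
      using powr_mono'[of "(p - 2) / 2" 0 "1 - u\<^sup>2"] assms by simp
    then have "2 \<le> A\<^sup>2 + B\<^sup>2"
      using sum_squares_bound[of A B] by simp
    then show ?thesis
      using assms by (simp add: h2_def sq)
  qed
  have h1_nonneg: "0 \<le> h1 u" if "0 \<le> u" "u < 1" for u
  proof -
    have "h1 0 \<le> h1 u"
    proof (rule DERIV_nonneg_imp_nondecreasing[of 0 u h1])
      show "\<exists>y. (h1 has_real_derivative y) (at v) \<and> 0 \<le> y" if "0 \<le> v" "v \<le> u" for v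
        using h2[of v] h2_nonneg[of v] that \<open>u < 1\<close> by auto
    qed (use that in simp)
    then show ?thesis by (simp add: h1_def)
  qed
  \<comment> \<open>The derivative formulas are established only for \<open>u < 1\<close>, so the
    endpoint \<open>t = 1\<close> is reached by continuity.\<close>
  have "continuous_on {0..t} h"
    unfolding h_def using assms by (intro continuous_intros continuous_on_powr') auto
  moreover have "\<exists>y. (h has_real_derivative y) (at v) \<and> 0 \<le> y" if "0 < v" "v < t" for v
    using h1[of v] h1_nonneg[of v] assms that by auto
  ultimately have "h 0 \<le> h t"
    using assms DERIV_nonneg_imp_increasing_open[of 0 t h] by blast
  then show ?thesis by (simp add: h_def)
qed

text \<open>By homogeneity take \<open>b = a * t\<close> with \<open>t\<close> in the unit interval.
  The concave power \<open>w powr (p / 2)\<close> lies below its tangent at 1, which is exactly half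
  of the second-order lower bound.\<close>

lemma two_point_hypercontractive:
  fixes a b p :: real
  assumes "1 < p" "p \<le> 2"
  shows "(a\<^sup>2 + (p - 1) * b\<^sup>2) powr (p / 2) \<le> (\<bar>a + b\<bar> powr p + \<bar>a - b\<bar> powr p) / 2"
proof -
  have *: "(a\<^sup>2 + (p - 1) * b\<^sup>2) powr (p / 2) \<le> (\<bar>a + b\<bar> powr p + \<bar>a - b\<bar> powr p) / 2"
    if "0 \<le> b" "b \<le> a" for a b
  proof (cases "a = 0")
    case False
    with that have "0 < a" by simp
    define t where "t = b / a"
    have t: "0 \<le> t" "t \<le> 1" and b: "b = a * t"
      using that \<open>0 < a\<close> by (simp_all add: t_def)
    define w where "w = 1 + (p - 1) * t\<^sup>2"
    have "1 \<le> w" using assms by (simp add: w_def)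
    \<comment> \<open>Young's inequality with weights \<open>p / 2\<close> and
      \<open>1 - p / 2\<close>, applied to \<open>w\<close> and 1, is the tangent bound.\<close>
    have "w powr (p / 2) \<le> 1 + p / 2 * (w - 1)"
      using \<open>1 \<le> w\<close> assms Youngs_inequality_0[of "p / 2" "1 - p / 2" w 1]
      by (simp add: algebra_simps diff_divide_distrib)
    also have "\<dots> \<le> ((1 + t) powr p + (1 - t) powr p) / 2"
      using powr_second_order_bound[of p t] assms t by (simp add: w_def algebra_simps)
    finally have "a powr p * w powr (p / 2) \<le> a powr p * (((1 + t) powr p + (1 - t) powr p) / 2)"
      by (rule mult_left_mono) simp
    moreover have "a\<^sup>2 + (p - 1) * b\<^sup>2 = a\<^sup>2 * w"
      by (simp add: w_def b power2_eq_square algebra_simps)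
    moreover have "\<bar>a + b\<bar> = a * (1 + t)" "\<bar>a - b\<bar> = a * (1 - t)"
      using that \<open>0 < a\<close> t by (simp_all add: b algebra_simps mult_left_le)
    moreover have "(a\<^sup>2 * w) powr (p / 2) = a powr p * w powr (p / 2)"
      using \<open>1 \<le> w\<close> \<open>0 < a\<close> by (simp add: powr_mult square_powr_half)
    moreover have "(a * (1 + t)) powr p = a powr p * (1 + t) powr p"
      "(a * (1 - t)) powr p = a powr p * (1 - t) powr p"
      using t \<open>0 < a\<close> by (simp_all add: powr_mult)
    ultimately show ?thesis
      by (simp only: distrib_left times_divide_eq_right)
  qed (use that in simp)
  \<comment> \<open>Since \<open>p - 1 \<le> 1\<close>, the left side is larger when the larger
    number carries the weight 1, so the case of dominating \<open>b\<close> reduces to the other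
    one.\<close>
  have swap: "a\<^sup>2 + (p - 1) * b\<^sup>2 \<le> b\<^sup>2 + (p - 1) * a\<^sup>2" if "\<bar>a\<bar> \<le> \<bar>b\<bar>"
  proof -
    have "0 \<le> (2 - p) * (b\<^sup>2 - a\<^sup>2)"
      using assms that abs_le_square_iff[of a b] by simp
    then show ?thesis by (simp add: algebra_simps)
  qed
  have sym: "\<bar>\<bar>a\<bar> + \<bar>b\<bar>\<bar> powr p + \<bar>\<bar>a\<bar> - \<bar>b\<bar>\<bar> powr p = \<bar>a + b\<bar> powr p + \<bar>a - b\<bar> powr p"
  proof -
    have "\<bar>\<bar>a\<bar> + \<bar>b\<bar>\<bar> = \<bar>a + b\<bar> \<and> \<bar>\<bar>a\<bar> - \<bar>b\<bar>\<bar> = \<bar>a - b\<bar> \<or>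
        \<bar>\<bar>a\<bar> + \<bar>b\<bar>\<bar> = \<bar>a - b\<bar> \<and> \<bar>\<bar>a\<bar> - \<bar>b\<bar>\<bar> = \<bar>a + b\<bar>"
      by linarith
    then show ?thesis by (elim disjE conjE) simp_all
  qed
  show ?thesis
  proof (cases "\<bar>b\<bar> \<le> \<bar>a\<bar>")
    case True
    then show ?thesis using *[of "\<bar>b\<bar>" "\<bar>a\<bar>"] sym by simp
  next
    case False
    then have "(a\<^sup>2 + (p - 1) * b\<^sup>2) powr (p / 2) \<le> (b\<^sup>2 + (p - 1) * a\<^sup>2) powr (p / 2)"
      using assms swap by (intro powr_mono2) auto
    also have "\<dots> \<le> (\<bar>a + b\<bar> powr p + \<bar>a - b\<bar> powr p) / 2"
      using *[of "\<bar>a\<bar>" "\<bar>b\<bar>"] False sym by (simp add: abs_minus_commute add.commute)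
    finally show ?thesis .
  qed
qed

text \<open>
  The bound \<open>p \<le> s\<close> is essential: \<open>s\<close> becomes the exponent \<open>q\<^sub>2\<close> of the contraction property.
\<close>

lemma two_point_uniform_convexity:
  fixes p :: real
  assumes "1 < p"
  obtains s c :: real where "p \<le> s" "0 < c"
    "\<And>a b. (\<bar>a\<bar> powr s + c * \<bar>b\<bar> powr s) powr (1 / s)
       \<le> ((\<bar>a + b\<bar> powr p + \<bar>a - b\<bar> powr p) / 2) powr (1 / p)"
proof (cases "2 \<le> p")
  case True
  show ?thesis
  proof (rule that[of p 1])
    show "(\<bar>a\<bar> powr p + 1 * \<bar>b\<bar> powr p) powr (1 / p)
       \<le> ((\<bar>a + b\<bar> powr p + \<bar>a - b\<bar> powr p) / 2) powr (1 / p)" for a b :: real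
      using two_point_clarkson[OF True, of a b] True by (intro powr_mono2) auto
  qed auto
next
  case False
  show ?thesis
  \<comment> \<open>For \<open>p < 2\<close> the weight \<open>p - 1\<close> is that of the
    hypercontractive inequality, and its \<open>p\<close>-th root turns the exponent
    \<open>p / 2\<close> into \<open>1 / 2\<close>.\<close>
  proof (rule that[of 2 "p - 1"])
    fix a b :: real
    define w where "w = a\<^sup>2 + (p - 1) * b\<^sup>2"
    have "0 \<le> w" using assms by (simp add: w_def)
    then have "w powr (1 / 2) = (w powr (p / 2)) powr (1 / p)"
      using assms by (simp add: powr_powr)
    also have "\<dots> \<le> ((\<bar>a + b\<bar> powr p + \<bar>a - b\<bar> powr p) / 2) powr (1 / p)"
      using two_point_hypercontractive[of p a b] False assms
      by (intro powr_mono2) (auto simp: w_def)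
    finally show "(\<bar>a\<bar> powr 2 + (p - 1) * \<bar>b\<bar> powr 2) powr (1 / 2)
       \<le> ((\<bar>a + b\<bar> powr p + \<bar>a - b\<bar> powr p) / 2) powr (1 / p)"
      by (simp add: w_def)
  qed (use False assms in auto)
qed

section \<open>Cosets of the constants\<close>

lemma const_coset_eq: "const_coset f = range (\<lambda>c x. f x + c)"
  by (auto simp: const_coset_def const_funs_def plus_fun_def)

text \<open>The metric on the quotient is built from the left-hand expression; this identifies the
  distance of two cosets with the norm of the coset of a difference.\<close>

lemma coset_diff:
  "coset_add (const_coset f) (coset_scale (- 1) (const_coset g)) = const_coset (f - g)"
proof (intro Set.set_eqI iffI)
  fix h assume "h \<in> coset_add (const_coset f) (coset_scale (- 1) (const_coset g))"
  then obtain a b c where "h = (\<lambda>x. f x + a + (- 1 * (g x + b) + c))"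
    unfolding coset_add_def coset_scale_def const_coset_eq const_funs_def plus_fun_def by blast
  then have "h = (\<lambda>x. (f - g) x + (a - b + c))"
    by (simp add: algebra_simps)
  then show "h \<in> const_coset (f - g)"
    by (auto simp: const_coset_eq)
next
  fix h assume "h \<in> const_coset (f - g)"
  then obtain a where "h = (\<lambda>x. (f - g) x + a)"
    by (auto simp: const_coset_eq)
  then have h: "h = (\<lambda>x. f x + a) + ((\<lambda>x. - 1 * g x) + 0)"
    by (auto simp: fun_eq_iff)
  have "(\<lambda>x. f x + a) \<in> const_coset f" "g \<in> const_coset g" "0 \<in> const_funs"
    by (auto simp: const_coset_eq const_funs_def zero_fun_def intro: range_eqI[of _ _ 0])
  then show "h \<in> coset_add (const_coset f) (coset_scale (- 1) (const_coset g))"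
    unfolding h coset_add_def coset_scale_def by blast
qed

lemma const_coset_eq_iff: "const_coset f = const_coset g \<longleftrightarrow> f - g \<in> const_funs"
proof
  assume "const_coset f = const_coset g"
  moreover have "f \<in> const_coset f"
    by (auto simp: const_coset_eq intro: range_eqI[of _ _ 0])
  ultimately obtain c where "f = (\<lambda>x. g x + c)"
    by (auto simp: const_coset_eq)
  then show "f - g \<in> const_funs"
    by (auto simp: const_funs_def fun_diff_def)
next
  assume "f - g \<in> const_funs"
  then obtain c where c: "f - g = (\<lambda>_. c)" by (auto simp: const_funs_def)
  have f: "f x = g x + c" for x using fun_cong[OF c, of x] by simp
  \<comment> \<open>Shifting by \<open>c\<close> only reparametrizes the family of translates by a
    bijection of the reals.\<close>
  have "(\<lambda>c x. f x + c) = (\<lambda>c x. g x + c) \<circ> (\<lambda>a. c + a)"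
    by (simp add: f fun_eq_iff)
  moreover have "range (\<lambda>a. c + a) = UNIV"
    by simp
  ultimately show "const_coset f = const_coset g"
    unfolding const_coset_eq by (simp only: image_comp[symmetric])
qed

section \<open>Consequences of the generalized contraction property\<close>

lemma lq_norm_2: "0 < q \<Longrightarrow>
    lq_norm (ereal q) 2 v = (\<bar>v 0\<bar> powr q + \<bar>v 1\<bar> powr q) powr (1 / q)"
  by (simp add: lq_norm_def numeral_2_eq_2)

locale p_resistance =
  fixes p :: real and E :: "('a \<Rightarrow> real) \<Rightarrow> ennreal"
  assumes p_gt_1: "1 < p" and form: "p_resistance_form p E"
begin

abbreviation D :: "('a \<Rightarrow> real) set" where "D \<equiv> energy_domain E"
abbreviation N :: "('a \<Rightarrow> real) \<Rightarrow> real" where "N \<equiv> energy_root p E"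

section \<open>Seminorm calculus on \<open>D\<close> and the passage between \<open>E\<close> and
  its root\<close>

lemma seminorm: "seminorm_on D N"
  using form by (simp add: p_resistance_form_def)

lemma zero_in_domain: "0 \<in> D"
  and add_in_domain: "f \<in> D \<Longrightarrow> g \<in> D \<Longrightarrow> f + g \<in> D"
  and scale_in_domain: "f \<in> D \<Longrightarrow> (\<lambda>x. a * f x) \<in> D"
  and root_scale: "f \<in> D \<Longrightarrow> N (\<lambda>x. a * f x) = \<bar>a\<bar> * N f"
  and root_add: "f \<in> D \<Longrightarrow> g \<in> D \<Longrightarrow> N (f + g) \<le> N f + N g"
  using seminorm by (auto simp: seminorm_on_def)

lemma root_nonneg: "0 \<le> N f"
  by (simp add: energy_root_def)

lemma uminus_in_domain: "f \<in> D \<Longrightarrow> - f \<in> D"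
  using scale_in_domain[of f "-1"] by (simp add: fun_Compl_def)

lemma diff_in_domain: "f \<in> D \<Longrightarrow> g \<in> D \<Longrightarrow> f - g \<in> D"
  using add_in_domain[of f "- g"] uminus_in_domain[of g] by simp

lemma root_uminus: "f \<in> D \<Longrightarrow> N (- f) = N f"
  using root_scale[of f "-1"] by (simp add: fun_Compl_def)

lemma root_diff_commute: "f \<in> D \<Longrightarrow> g \<in> D \<Longrightarrow> N (f - g) = N (g - f)"
  using root_uminus[of "f - g"] diff_in_domain by simp

lemma root_diff_triangle:
  assumes "f \<in> D" "g \<in> D" "h \<in> D"
  shows "N (f - h) \<le> N (f - g) + N (g - h)"
  using root_add[of "f - g" "g - h"] assms by (simp add: diff_in_domain)

lemma energy_eq: "f \<in> D \<Longrightarrow> E f = ennreal (N f powr p)"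
  using p_gt_1 by (simp add: energy_root_def energy_domain_def powr_powr less_top)

lemma energy_le_iff:
  assumes "f \<in> D" "0 \<le> c"
  shows "E f \<le> ennreal (c powr p) \<longleftrightarrow> N f \<le> c"
proof -
  have "N f powr p \<le> c powr p \<longleftrightarrow> N f \<le> c"
    using p_gt_1 assms root_nonneg[of f] powr_mono2[of p "N f" c] powr_less_mono2[of p c "N f"]
    by linarith
  then show ?thesis using assms by (simp add: energy_eq)
qed

lemma in_domain_if_le: "E f \<le> ennreal c \<Longrightarrow> f \<in> D"
  by (simp add: energy_domain_def le_less_trans[OF _ ennreal_less_top])

lemma energy_eq_top: "f \<notin> D \<Longrightarrow> E f = \<infinity>"
  by (simp add: energy_domain_def less_top[symmetric])

text \<open>Membership in \<open>D\<close> must be demanded separately, since \<open>N\<close> takes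
  the default value 0 on functions of infinite energy.\<close>

lemma const_funs_iff: "f \<in> const_funs \<longleftrightarrow> f \<in> D \<and> N f = 0"
proof -
  have "f \<in> const_funs \<longleftrightarrow> E f = 0"
    using form by (auto simp: p_resistance_form_def energy_kernel_def)
  also have "\<dots> \<longleftrightarrow> f \<in> D \<and> N f = 0"
    by (auto simp: energy_eq) (auto simp: energy_domain_def energy_root_def)
  finally show ?thesis .
qed

text \<open>The contraction property for maps of the plane with exponents \<open>p\<close> and
  \<open>s\<close>. It serves normal contractions with \<open>s = p\<close> and uniform convexity
  with the exponent of the two-point inequality.\<close>

lemma contraction_2:
  assumes "p \<le> s" "T1 0 0 = 0" "T2 0 0 = 0"
    and lip: "\<And>u v u' v'. (\<bar>T1 u v - T1 u' v'\<bar> powr s + \<bar>T2 u v - T2 u' v'\<bar> powr s) powr (1 / s)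
       \<le> (\<bar>u - u'\<bar> powr p + \<bar>v - v'\<bar> powr p) powr (1 / p)"
    and "f \<in> D" "g \<in> D"
  shows "(\<lambda>x. T1 (f x) (g x)) \<in> D" "(\<lambda>x. T2 (f x) (g x)) \<in> D"
    "(N (\<lambda>x. T1 (f x) (g x)) powr s + N (\<lambda>x. T2 (f x) (g x)) powr s) powr (1 / s)
       \<le> (N f powr p + N g powr p) powr (1 / p)"
proof -
  define T where "T = (\<lambda>(x :: nat \<Rightarrow> real) j :: nat. if j = 0 then T1 (x 0) (x 1) else T2 (x 0) (x 1))"
  define F where "F = (\<lambda>i :: nat. if i = 0 then f else g)"
  have gcp: "generalized_contraction_property p E"
    using form by (simp add: p_resistance_form_def)
  have *: "1 \<le> ereal p \<and> ereal p \<le> ereal p \<and> ereal p \<le> ereal s \<and> ereal s \<le> \<infinity> \<and>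
      1 \<le> (2::nat) \<and> 1 \<le> (2::nat) \<and> (\<forall>j<2. T (\<lambda>_. 0) j = 0) \<and>
      (\<forall>x y. lq_norm s 2 (T x - T y) \<le> lq_norm p 2 (x - y)) \<and> (\<forall>i<2. F i \<in> D)"
    using assms p_gt_1 by (simp add: T_def F_def lq_norm_2)
  have dom: "\<forall>j<2. (\<lambda>x. T (\<lambda>i. F i x) j) \<in> D"
    and le: "lq_norm s 2 (\<lambda>j. N (\<lambda>x. T (\<lambda>i. F i x) j)) \<le> lq_norm p 2 (\<lambda>i. N (F i))"
    using gcp * unfolding generalized_contraction_property_def by blast+
  show "(\<lambda>x. T1 (f x) (g x)) \<in> D" "(\<lambda>x. T2 (f x) (g x)) \<in> D"
    using dom[rule_format, of 0] dom[rule_format, of 1] by (simp_all add: T_def F_def)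
  show "(N (\<lambda>x. T1 (f x) (g x)) powr s + N (\<lambda>x. T2 (f x) (g x)) powr s) powr (1 / s)
       \<le> (N f powr p + N g powr p) powr (1 / p)"
    using le p_gt_1 \<open>p \<le> s\<close> by (simp add: T_def F_def lq_norm_2 root_nonneg)
qed

text \<open>In the variables \<open>u = f + g\<close> and \<open>v = f - g\<close>, passing to
  \<open>f + (C \<circ> g)\<close> and \<open>f - (C \<circ> g)\<close> is a map of the plane that
  fixes 0 and contracts the \<open>p\<close>-norm.\<close>

lemma normal_contractions: "normal_contractions_operate E"
  unfolding normal_contractions_operate_def
proof (intro allI impI)
  fix C :: "real \<Rightarrow> real" and f g :: "'a \<Rightarrow> real"
  assume C: "1-lipschitz_on UNIV C \<and> C 0 = 0"
  show "E (f + (C \<circ> g)) + E (f - (C \<circ> g)) \<le> E (f + g) + E (f - g)"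
  proof (cases "f + g \<in> D \<and> f - g \<in> D")
    case False
    then show ?thesis by (auto simp: energy_eq_top)
  next
    case True
    define T1 T2 where "T1 = (\<lambda>u v. (u + v) / 2 + C ((u - v) / 2))"
      and "T2 = (\<lambda>u v. (u + v) / 2 - C ((u - v) / 2))"
    have lip: "(\<bar>T1 u v - T1 u' v'\<bar> powr p + \<bar>T2 u v - T2 u' v'\<bar> powr p) powr (1 / p)
       \<le> (\<bar>u - u'\<bar> powr p + \<bar>v - v'\<bar> powr p) powr (1 / p)" for u v u' v'
    proof -
      \<comment> \<open>Half-sum and half-difference of the increments, and the increment of
        \<open>C\<close>; the Lipschitz bound becomes
        \<open>\<bar>c\<bar> \<le> \<bar>b\<bar>\<close>.\<close>
      define a b c where "a = ((u - u') + (v - v')) / 2" and "b = ((u - u') - (v - v')) / 2"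
        and "c = C ((u - v) / 2) - C ((u' - v') / 2)"
      have "dist (C ((u - v) / 2)) (C ((u' - v') / 2)) \<le> 1 * dist ((u - v) / 2) ((u' - v') / 2)"
        using C by (intro lipschitz_onD) auto
      moreover have "(u - v) / 2 - (u' - v') / 2 = b"
        by (simp add: b_def field_simps)
      ultimately have "\<bar>c\<bar> \<le> \<bar>b\<bar>"
        by (simp add: c_def dist_real_def)
      moreover have "T1 u v - T1 u' v' = a + c" "T2 u v - T2 u' v' = a - c" "u - u' = a + b" "v - v' = a - b"
        by (simp_all add: T1_def T2_def a_def b_def c_def field_simps)
      ultimately show ?thesis
        using powr_sum_diff_mono[OF p_gt_1] p_gt_1 by (auto intro!: powr_mono2)
    qed
    have eq: "(\<lambda>x. T1 ((f + g) x) ((f - g) x)) = f + (C \<circ> g)"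
      "(\<lambda>x. T2 ((f + g) x) ((f - g) x)) = f - (C \<circ> g)"
      by (auto simp: T1_def T2_def)
    note c2 = contraction_2[of p T1 T2 "f + g" "f - g", OF _ _ _ lip, unfolded eq]
    have dom: "f + (C \<circ> g) \<in> D" "f - (C \<circ> g) \<in> D"
      using c2(1,2) C True by (simp_all add: T1_def T2_def)
    have "(N (f + (C \<circ> g)) powr p + N (f - (C \<circ> g)) powr p) powr (1 / p)
        \<le> (N (f + g) powr p + N (f - g) powr p) powr (1 / p)"
      using c2(3) C True by (simp add: T1_def T2_def)
    then have "N (f + (C \<circ> g)) powr p + N (f - (C \<circ> g)) powr p \<le> N (f + g) powr p + N (f - g) powr p"
      using p_gt_1 powr_less_mono2[of "1 / p" "N (f + g) powr p + N (f - g) powr p"]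
      by (smt (verit) powr_ge_zero zero_less_divide_1_iff)
    then show ?thesis
      using True dom by (simp add: energy_eq ennreal_leI flip: ennreal_plus)
  qed
qed

text \<open>The two-point inequality says that a suitably weighted linear map to midpoint and
  half-difference is a contraction of the plane; the contraction property carries it over from
  numbers to energy roots.\<close>

lemma uniform_convexity:
  obtains s c :: real where "p \<le> s" "0 < c"
    "\<And>f g. f \<in> D \<Longrightarrow> g \<in> D \<Longrightarrow>
       (N (\<lambda>x. (f x + g x) / 2) powr s + c * N (\<lambda>x. (f x - g x) / 2) powr s) powr (1 / s)
       \<le> ((N f powr p + N g powr p) / 2) powr (1 / p)"
proof -
  obtain s c :: real where s: "p \<le> s" and c: "0 < c"
    and ineq: "\<And>a b. (\<bar>a\<bar> powr s + c * \<bar>b\<bar> powr s) powr (1 / s)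
       \<le> ((\<bar>a + b\<bar> powr p + \<bar>a - b\<bar> powr p) / 2) powr (1 / p)"
    using two_point_uniform_convexity[OF p_gt_1] by blast
  \<comment> \<open>\<open>k\<close> absorbs the factor 1/2 in the mean on the right, and the extra
    factor in \<open>l\<close> produces the weight \<open>c\<close>.\<close>
  define k where "k = 2 powr (1 / p)"
  define l where "l = k * c powr (1 / s)"
  have "0 < k" "0 < l" using c by (simp_all add: k_def l_def)
  have scale: "(\<bar>k * a\<bar> powr s + \<bar>l * b\<bar> powr s) powr (1 / s) = k * (\<bar>a\<bar> powr s + c * \<bar>b\<bar> powr s) powr (1 / s)"
    for a b
  proof -
    have "\<bar>k * a\<bar> powr s + \<bar>l * b\<bar> powr s = k powr s * (\<bar>a\<bar> powr s + c * \<bar>b\<bar> powr s)"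
      using s p_gt_1 c \<open>0 < k\<close> by (simp add: l_def abs_mult powr_mult powr_powr algebra_simps)
    then show ?thesis
      using s p_gt_1 c \<open>0 < k\<close> by (simp add: powr_mult powr_powr)
  qed
  have half: "k * (w / 2) powr (1 / p) = w powr (1 / p)" if "0 \<le> w" for w
    using that by (simp add: k_def powr_divide)
  define T1 T2 where "T1 = (\<lambda>u v. k * ((u + v) / 2))" and "T2 = (\<lambda>u v. l * ((u - v) / 2))"
  have lip: "(\<bar>T1 u v - T1 u' v'\<bar> powr s + \<bar>T2 u v - T2 u' v'\<bar> powr s) powr (1 / s)
       \<le> (\<bar>u - u'\<bar> powr p + \<bar>v - v'\<bar> powr p) powr (1 / p)" for u v u' v'
  proof -
    define a b where "a = ((u - u') + (v - v')) / 2" and "b = ((u - u') - (v - v')) / 2"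
    have "T1 u v - T1 u' v' = k * a" "T2 u v - T2 u' v' = l * b" "u - u' = a + b" "v - v' = a - b"
      by (simp_all add: T1_def T2_def a_def b_def field_simps)
    then show ?thesis
      using mult_left_mono[OF ineq[of a b], of k] \<open>0 < k\<close> by (simp only: scale) (simp add: half)
  qed
  show ?thesis
  proof (rule that[OF s c])
    fix f g assume fg: "f \<in> D" "g \<in> D"
    define A B where "A = (\<lambda>x. (f x + g x) / 2)" and "B = (\<lambda>x. (f x - g x) / 2)"
    have AB: "A \<in> D" "B \<in> D"
      using fg scale_in_domain[of "f + g" "1/2"] scale_in_domain[of "f - g" "1/2"]
      by (simp_all add: A_def B_def add_in_domain diff_in_domain)
    have "(N (\<lambda>x. k * A x) powr s + N (\<lambda>x. l * B x) powr s) powr (1 / s)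
       \<le> (N f powr p + N g powr p) powr (1 / p)"
      using contraction_2(3)[of s T1 T2 f g, OF s _ _ lip fg] by (simp add: T1_def T2_def A_def B_def)
    then have "k * (N A powr s + c * N B powr s) powr (1 / s) \<le> k * ((N f powr p + N g powr p) / 2) powr (1 / p)"
      using scale[of "N A" "N B"] \<open>0 < k\<close> \<open>0 < l\<close>
      by (simp add: root_scale AB half abs_mult root_nonneg)
    then show "(N (\<lambda>x. (f x + g x) / 2) powr s + c * N (\<lambda>x. (f x - g x) / 2) powr s) powr (1 / s)
       \<le> ((N f powr p + N g powr p) / 2) powr (1 / p)"
      using \<open>0 < k\<close> by (simp add: A_def B_def)
  qed
qed

text \<open>The triangle inequality for \<open>N\<close> is followed by convexity of the
  \<open>p\<close>-th power. The endpoints are split off so that both weights are positive and an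
  infinite energy makes the right side infinite.\<close>

lemma convex: "convex_functional E"
  unfolding convex_functional_def
proof (intro allI impI)
  fix f g :: "'a \<Rightarrow> real" and t :: real
  assume "0 \<le> t \<and> t \<le> 1"
  then consider "t = 0" | "t = 1" | "0 < t" "t < 1" by linarith
  then show "E (\<lambda>x. (1 - t) * f x + t * g x) \<le> ennreal (1 - t) * E f + ennreal t * E g"
  proof cases
    case 3
    show ?thesis
    proof (cases "f \<in> D \<and> g \<in> D")
      case False
      then have "ennreal (1 - t) * E f + ennreal t * E g = \<infinity>"
        using 3 by (auto simp: energy_eq_top ennreal_mult_top)
      then show ?thesis by (simp only: infinity_ennreal_def top_greatest)
    next
      case True
      let ?h = "(\<lambda>x. (1 - t) * f x) + (\<lambda>x. t * g x)"
      have h: "?h \<in> D" using True by (simp add: add_in_domain scale_in_domain)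
      have "N ?h \<le> (1 - t) * N f + t * N g"
        using True 3 root_add[of "\<lambda>x. (1 - t) * f x" "\<lambda>x. t * g x"]
        by (simp add: scale_in_domain root_scale)
      then have "N ?h powr p \<le> ((1 - t) * N f + t * N g) powr p"
        using p_gt_1 root_nonneg by (intro powr_mono2) auto
      also have "\<dots> \<le> (1 - t) * N f powr p + t * N g powr p"
        using p_gt_1 3 root_nonneg by (intro powr_convex_nonneg) auto
      finally have "E ?h \<le> ennreal (1 - t) * E f + ennreal t * E g"
        using True 3 h by (simp add: energy_eq ennreal_leI flip: ennreal_plus ennreal_mult)
      then show ?thesis by (simp add: plus_fun_def)
    qed
  qed simp_all
qed

section \<open>Completeness and the resistance estimate\<close>

text \<open>Constants have seminorm zero, so the triangle inequality applies in both
  directions.\<close>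

lemma root_cong_const:
  assumes "f \<in> D" "g - f \<in> const_funs"
  shows "g \<in> D" "N g = N f"
proof -
  have k: "g - f \<in> D" "N (g - f) = 0"
    using assms(2) by (simp_all add: const_funs_iff)
  show g: "g \<in> D"
    using add_in_domain[OF assms(1) k(1)] by simp
  show "N g = N f"
    using root_add[OF assms(1) k(1)] root_add[OF g uminus_in_domain[OF k(1)]] k root_uminus[of "g - f"]
    by simp
qed

lemma quotient_norm_coset:
  assumes "f \<in> D"
  shows "quotient_norm N (const_coset f) = N f"
proof -
  have "N (\<lambda>x. f x + c) = N f" for c
    using assms by (intro root_cong_const(2)) (auto simp: const_funs_def fun_diff_def)
  then have "N ` const_coset f = {N f}"
    by (auto simp: const_coset_eq image_iff)
  then show ?thesis by (simp add: quotient_norm_def)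
qed

text \<open>Completeness of the quotient, restated for sequences of representatives.\<close>

lemma root_complete:
  assumes h: "\<And>n. h n \<in> D"
    and cauchy: "\<And>\<epsilon>. 0 < \<epsilon> \<Longrightarrow> \<exists>K. \<forall>m\<ge>K. \<forall>n\<ge>K. N (h m - h n) < \<epsilon>"
  obtains l where "l \<in> D" "(\<lambda>n. N (h n - l)) \<longlonglongrightarrow> 0"
proof -
  define Q where "Q = const_coset ` D"
  \<comment> \<open>This repeats the metric of \<open>banach_space_on\<close>, cut-off included, so
    that the completeness hypothesis applies to it directly.\<close>
  define d where "d = (\<lambda>u v. if u \<in> Q \<and> v \<in> Q
    then quotient_norm N (coset_add u (coset_scale (- 1) v)) else 0)"
  have d: "d (const_coset f) (const_coset g) = N (f - g)" if "f \<in> D" "g \<in> D" for f g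
    using that by (simp add: d_def Q_def coset_diff quotient_norm_coset diff_in_domain)
  interpret Metric_space Q d
  proof
    show "0 \<le> d u v" for u v
    proof (cases "u \<in> Q \<and> v \<in> Q")
      case True
      then show ?thesis by (auto simp: Q_def d root_nonneg)
    qed (auto simp: d_def)
    show "d u v = d v u" for u v
    proof (cases "u \<in> Q \<and> v \<in> Q")
      case True
      then show ?thesis by (auto simp: Q_def d intro: root_diff_commute)
    qed (auto simp: d_def)
    \<comment> \<open>Separation of points is where the kernel being exactly the constants
      enters.\<close>
    show "d u v = 0 \<longleftrightarrow> u = v" if uv: "u \<in> Q" "v \<in> Q" for u v
    proof -
      obtain f g where fg: "f \<in> D" "g \<in> D" "u = const_coset f" "v = const_coset g"
        using uv by (auto simp: Q_def)
      have "d u v = 0 \<longleftrightarrow> f - g \<in> const_funs"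
        using fg by (simp add: d const_funs_iff diff_in_domain)
      then show ?thesis by (simp only: fg const_coset_eq_iff)
    qed
    show "d u w \<le> d u v + d v w" if "u \<in> Q" "v \<in> Q" "w \<in> Q" for u v w
      using that by (auto simp: Q_def d intro: root_diff_triangle)
  qed
  have "mcomplete"
    using form unfolding p_resistance_form_def banach_space_on_def d_def Q_def by simp
  moreover have "MCauchy (\<lambda>n. const_coset (h n))"
    unfolding MCauchy_def using h cauchy by (auto simp: d) (auto simp: Q_def)
  ultimately obtain u where u: "limitin mtopology (\<lambda>n. const_coset (h n)) u sequentially"
    unfolding mcomplete_def by blast
  then have "u \<in> Q" "(\<lambda>n. d (const_coset (h n)) u) \<longlonglongrightarrow> 0"
    by (simp_all add: limitin_metric_dist_null)
  then obtain l where "l \<in> D" "u = const_coset l" by (auto simp: Q_def)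
  with \<open>(\<lambda>n. d (const_coset (h n)) u) \<longlonglongrightarrow> 0\<close> show ?thesis
    using that h by (simp add: d)
qed

text \<open>Rescale \<open>u\<close> to energy 1 and use the definition of the resistance; if
  \<open>N u = 0\<close>, then \<open>u\<close> is constant. Passing to \<open>- u\<close> gives the
  absolute value.\<close>

lemma resistance_bound:
  obtains r where "\<And>u. u \<in> D \<Longrightarrow> \<bar>u x - u y\<bar> \<le> r * N u"
proof -
  have zero: "E 0 = 0"
    using energy_eq[OF zero_in_domain] const_funs_iff[of 0] by (auto simp: const_funs_def zero_fun_def)
  have fin: "resistance E x y < \<infinity>"
    using form by (simp add: p_resistance_form_def)
  have upper: "ereal (u x - u y) \<le> resistance E x y" if "E u \<le> 1" for u
    unfolding resistance_def using that by (intro SUP_upper) simp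
  \<comment> \<open>Testing with the zero function excludes the value minus infinity, so the
    resistance is a real number.\<close>
  have "0 \<le> resistance E x y"
    using upper[of 0] zero by (simp add: zero_ereal_def)
  then obtain r where r: "resistance E x y = ereal r"
    using fin by (cases "resistance E x y") auto
  have one_sided: "u x - u y \<le> r * N u" if u: "u \<in> D" for u
  proof (cases "N u = 0")
    case True
    then show ?thesis
      using u const_funs_iff[of u] by (auto simp: const_funs_def)
  next
    case False
    with root_nonneg[of u] have pos: "0 < N u" by linarith
    define v where "v = (\<lambda>z. (1 / N u) * u z)"
    have "v \<in> D" "N v = 1"
      using u pos by (simp_all only: v_def scale_in_domain root_scale) simp
    then have "E v \<le> 1" using energy_eq[of v] by simp
    from upper[OF this] have "v x - v y \<le> r" by (simp add: r)
    then show ?thesis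
      using pos by (simp add: v_def field_simps)
  qed
  show ?thesis
  proof (rule that)
    fix u assume u: "u \<in> D"
    show "\<bar>u x - u y\<bar> \<le> r * N u"
      using one_sided[OF u] one_sided[OF uminus_in_domain[OF u]] root_uminus[OF u] by simp
  qed
qed

section \<open>Lower semicontinuity\<close>

text \<open>Uniform convexity in quantitative form: if two functions have root at most
  \<open>M + 1 / Suc k\<close> and their midpoint at least \<open>M - 1 / Suc k\<close>, little room
  is left for their difference.\<close>

lemma near_minimizers_close:
  assumes "0 \<le> M"
  obtains \<delta> :: "nat \<Rightarrow> real" where "\<delta> \<longlonglongrightarrow> 0"
    "\<And>k u v. u \<in> D \<Longrightarrow> v \<in> D \<Longrightarrow> N u \<le> M + 1 / Suc k \<Longrightarrow> N v \<le> M + 1 / Suc k \<Longrightarrow>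
       M - 1 / Suc k \<le> N (\<lambda>x. (u x + v x) / 2) \<Longrightarrow> N (u - v) \<le> \<delta> k"
proof -
  obtain s c :: real where s: "p \<le> s" and c: "0 < c" and uc:
    "\<And>f g. f \<in> D \<Longrightarrow> g \<in> D \<Longrightarrow>
       (N (\<lambda>x. (f x + g x) / 2) powr s + c * N (\<lambda>x. (f x - g x) / 2) powr s) powr (1 / s)
       \<le> ((N f powr p + N g powr p) / 2) powr (1 / p)"
    using uniform_convexity by blast
  have s0: "0 < s" using s p_gt_1 by simp
  \<comment> \<open>The bound solves the uniform convexity inequality for the half-difference, hence
    the factor 2; \<open>max 0\<close> covers levels \<open>M\<close> below
    \<open>1 / Suc k\<close>.\<close>
  define \<delta> where "\<delta> = (\<lambda>k::nat. 2 * (((M + 1 / Suc k) powr s - max 0 (M - 1 / Suc k) powr s) / c) powr (1 / s))"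
  have eps: "(\<lambda>k. 1 / real (Suc k)) \<longlonglongrightarrow> 0"
    by (rule LIMSEQ_Suc[OF lim_1_over_n])
  show ?thesis
  proof (rule that)
    fix k u v
    assume u: "u \<in> D" and v: "v \<in> D"
      and le: "N u \<le> M + 1 / Suc k" "N v \<le> M + 1 / Suc k"
      and mid: "M - 1 / Suc k \<le> N (\<lambda>x. (u x + v x) / 2)"
    define a b where "a = N (\<lambda>x. (u x + v x) / 2)" and "b = N (\<lambda>x. (u x - v x) / 2)"
    define \<beta> where "\<beta> = M + 1 / Suc k"
    have ab: "0 \<le> a" "0 \<le> b" "0 \<le> \<beta>"
      using assms by (simp_all add: a_def b_def \<beta>_def root_nonneg)
    have "N u powr p \<le> \<beta> powr p" "N v powr p \<le> \<beta> powr p"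
      using le p_gt_1 by (auto simp: \<beta>_def intro!: powr_mono2 root_nonneg)
    then have "((N u powr p + N v powr p) / 2) powr (1 / p) \<le> (\<beta> powr p) powr (1 / p)"
      using p_gt_1 by (intro powr_mono2) auto
    also have "\<dots> = \<beta>" using ab p_gt_1 by (simp add: powr_powr)
    finally have "(a powr s + c * b powr s) powr (1 / s) \<le> \<beta>"
      using uc[OF u v] by (simp add: a_def b_def)
    then have "((a powr s + c * b powr s) powr (1 / s)) powr s \<le> \<beta> powr s"
      using s0 by (intro powr_mono2) auto
    then have "a powr s + c * b powr s \<le> \<beta> powr s"
      using s0 c by (simp add: powr_powr)
    moreover have "max 0 (M - 1 / Suc k) powr s \<le> a powr s"
      using mid ab s0 by (intro powr_mono2) (auto simp: a_def)
    ultimately have "b powr s \<le> (\<beta> powr s - max 0 (M - 1 / Suc k) powr s) / c"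
      using c by (simp add: field_simps)
    then have "(b powr s) powr (1 / s) \<le> ((\<beta> powr s - max 0 (M - 1 / Suc k) powr s) / c) powr (1 / s)"
      using s0 by (intro powr_mono2) auto
    then have "2 * b \<le> \<delta> k"
      using s0 ab by (simp add: \<delta>_def \<beta>_def powr_powr)
    moreover have "N (u - v) = 2 * b"
      using root_scale[OF diff_in_domain[OF u v], of "1 / 2"] by (simp add: b_def)
    ultimately show "N (u - v) \<le> \<delta> k" by simp
  next
    show "\<delta> \<longlonglongrightarrow> 0"
    proof -
      have up: "(\<lambda>k. (M + 1 / Suc k) powr s) \<longlonglongrightarrow> (M + 0) powr s"
        using assms s0 by (intro tendsto_powr2 tendsto_max tendsto_add tendsto_diff tendsto_const eps) auto
      have down: "(\<lambda>k. max 0 (M - 1 / Suc k) powr s) \<longlonglongrightarrow> max 0 (M - 0) powr s"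
        using s0 by (intro tendsto_powr2 tendsto_max tendsto_add tendsto_diff tendsto_const eps) auto
      have "(M + 1 / Suc k) powr s - max 0 (M - 1 / Suc k) powr s \<ge> 0" for k
        using assms s0 by (auto intro!: powr_mono2)
      then have "\<delta> \<longlonglongrightarrow> 2 * (((M + 0) powr s - max 0 (M - 0) powr s) / c) powr (1 / s)"
        unfolding \<delta>_def using s0 c
        by (intro tendsto_mult_left tendsto_divide tendsto_diff tendsto_const tendsto_powr2 up down) (auto intro!: always_eventually)
      then show ?thesis using assms by simp
    qed
  qed
qed

text \<open>The hypothesis places \<open>f\<close> in the pointwise closure of the sublevel set of
  \<open>N\<close> at level \<open>L\<close>, with basic neighbourhoods given by a finite set
  \<open>A\<close> and a tolerance \<open>1 / Suc n\<close>.\<close>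

lemma sublevel_closed:
  fixes f :: "'a \<Rightarrow> real"
  assumes near: "\<And>A n. finite A \<Longrightarrow>
      \<exists>h\<in>D. (\<forall>x\<in>A. \<bar>h x - f x\<bar> < 1 / Suc n) \<and> N h \<le> L"
  shows "f \<in> D \<and> N f \<le> L"
proof -
  define near where "near = (\<lambda>A n h. \<forall>x\<in>A. \<bar>h x - f x\<bar> < 1 / Suc n)"
  have near_mono: "near A n h" if "near B m h" "A \<subseteq> B" "n \<le> m" for A B n m h
  proof -
    have "1 / Suc m \<le> 1 / Suc n" using that(3) by (simp add: frac_le)
    then show ?thesis using that(1,2) unfolding near_def by fastforce
  qed
  have near_mid: "near A n (\<lambda>x. (u x + v x) / 2)" if "near A n u" "near A n v" for A n u v
    unfolding near_def
  proof
    fix x assume "x \<in> A"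
    then have "\<bar>u x - f x\<bar> < 1 / Suc n" "\<bar>v x - f x\<bar> < 1 / Suc n"
      using that by (auto simp: near_def)
    then show "\<bar>(u x + v x) / 2 - f x\<bar> < 1 / Suc n" by (simp add: abs_less_iff field_simps)
  qed
  define good where "good = {M. \<forall>A n. finite A \<longrightarrow> (\<exists>h\<in>D. near A n h \<and> N h \<le> M)}"
  define M where "M = Inf good"
  have "L \<in> good" using near by (auto simp: good_def near_def)
  have good_nonneg: "0 \<le> m" if "m \<in> good" for m
    using that root_nonneg order_trans unfolding good_def by blast
  then have bdd: "bdd_below good" by (rule bdd_belowI)
  have "0 \<le> M" unfolding M_def using \<open>L \<in> good\<close> good_nonneg by (intro cInf_greatest) auto
  have "M \<le> L" unfolding M_def using \<open>L \<in> good\<close> bdd by (rule cInf_lower)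
  have approx: "\<exists>h\<in>D. near A n h \<and> N h \<le> M + 1 / Suc k" if "finite A" for A n k
  proof -
    have "Inf good < M + 1 / Suc k" by (simp add: M_def)
    then obtain m where "m \<in> good" "m < M + 1 / Suc k"
      using \<open>L \<in> good\<close> cInf_lessD[of good] by blast
    then show ?thesis using that unfolding good_def by (force intro: order_trans less_imp_le)
  qed
  \<comment> \<open>A level below the infimum is missed by some neighbourhood, and there it bounds
    \<open>N\<close> from below.\<close>
  have "\<exists>A n. finite A \<and> (\<forall>h\<in>D. near A n h \<longrightarrow> M - 1 / Suc k \<le> N h)" for k
  proof -
    have "M - 1 / Suc k \<notin> good"
      using cInf_lower[OF _ bdd, of "M - 1 / Suc k"] by (auto simp: M_def)
    then show ?thesis unfolding good_def by fastforce
  qed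
  then obtain A n where A: "\<And>k. finite (A k)"
    and lower: "\<And>k h. h \<in> D \<Longrightarrow> near (A k) (n k) h \<Longrightarrow> M - 1 / Suc k \<le> N h"
    by metis
  obtain \<delta> where \<delta>: "\<delta> \<longlonglongrightarrow> 0" and close0:
    "\<And>k u v. u \<in> D \<Longrightarrow> v \<in> D \<Longrightarrow> N u \<le> M + 1 / Suc k \<Longrightarrow> N v \<le> M + 1 / Suc k \<Longrightarrow>
       M - 1 / Suc k \<le> N (\<lambda>x. (u x + v x) / 2) \<Longrightarrow> N (u - v) \<le> \<delta> k"
    using near_minimizers_close[OF \<open>0 \<le> M\<close>] by blast
  \<comment> \<open>Neighbourhoods are convex, so the midpoint stays inside and obeys the lower
    bound there.\<close>
  have close: "N (u - v) \<le> \<delta> k"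
    if uv: "u \<in> D" "v \<in> D" and "N u \<le> M + 1 / Suc k" "N v \<le> M + 1 / Suc k"
      and "near (A k) (n k) u" "near (A k) (n k) v" for k u v
  proof -
    have "(\<lambda>x. (u x + v x) / 2) \<in> D"
      using scale_in_domain[OF add_in_domain[OF uv], of "1/2"] by simp
    then show ?thesis using that close0 lower near_mid by blast
  qed
  have "\<forall>k. \<exists>h. h \<in> D \<and> near (A k) (n k) h \<and> N h \<le> M + 1 / Suc k"
    using approx A by blast
  then obtain h where h: "\<And>k. h k \<in> D" "\<And>k. near (A k) (n k) (h k)" "\<And>k. N (h k) \<le> M + 1 / Suc k"
    by metis
  have h_dist: "N (h k - h j) \<le> \<delta> k + \<delta> j" for k j
  proof -
    \<comment> \<open>\<open>h k\<close> and \<open>h j\<close> live in different neighbourhoods; an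
      almost minimal \<open>g\<close> in the intersection is comparable with both.\<close>
    obtain g where g: "g \<in> D" "near (A k \<union> A j) (max (n k) (n j)) g" "N g \<le> M + 1 / Suc (max k j)"
      using approx[OF finite_UnI[OF A A]] by blast
    have "1 / Suc (max k j) \<le> 1 / Suc k" "1 / Suc (max k j) \<le> 1 / Suc j"
      by (simp_all add: frac_le)
    then have "N g \<le> M + 1 / Suc k" "N g \<le> M + 1 / Suc j"
      using g(3) by linarith+
    moreover have "near (A k) (n k) g" "near (A j) (n j) g"
      using g(2) by (auto elim: near_mono)
    ultimately have "N (h k - g) \<le> \<delta> k" "N (g - h j) \<le> \<delta> j"
      using close h g(1) by blast+
    then show ?thesis
      using root_diff_triangle[of "h k" g "h j"] h g(1) by fastforce
  qed
  have "\<exists>K. \<forall>i\<ge>K. \<forall>j\<ge>K. N (h i - h j) < \<epsilon>" if "0 < \<epsilon>" for \<epsilon>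
  proof -
    obtain K where "\<And>k. K \<le> k \<Longrightarrow> \<bar>\<delta> k\<bar> < \<epsilon> / 2"
      using LIMSEQ_D[OF \<delta>, of "\<epsilon> / 2"] \<open>0 < \<epsilon>\<close> by auto
    then have "N (h i - h j) < \<epsilon>" if "K \<le> i" "K \<le> j" for i j
      using h_dist[of i j] that by (smt (verit) field_sum_of_halves)
    then show ?thesis by blast
  qed
  then obtain l where l: "l \<in> D" and lim: "(\<lambda>k. N (h k - l)) \<longlonglongrightarrow> 0"
    using root_complete[of h] h(1) by blast
  have eps: "(\<lambda>k. 1 / real (Suc k)) \<longlonglongrightarrow> 0"
    by (rule LIMSEQ_Suc[OF lim_1_over_n])
  have diff: "l x - l y = f x - f y" for x y
  proof -
    obtain r where r: "\<And>u. u \<in> D \<Longrightarrow> \<bar>u x - u y\<bar> \<le> r * N u"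
      using resistance_bound by blast
    have bound: "\<bar>(l x - l y) - (f x - f y)\<bar> \<le> \<bar>r\<bar> * N (h k - l) + \<bar>r\<bar> * \<delta> k + 2 * (1 / Suc k)" for k
    proof -
      \<comment> \<open>\<open>h k\<close> is close to \<open>f\<close> only on \<open>A k\<close>.
        An almost minimal \<open>g\<close> that also approximates \<open>f\<close> at
        \<open>x\<close> and \<open>y\<close> is close to \<open>h k\<close> in energy, and the
        resistance estimate turns this into closeness of differences of values.\<close>
      obtain g where g: "g \<in> D" "near (A k \<union> {x, y}) (max (n k) k) g" "N g \<le> M + 1 / Suc k"
        using approx[of "A k \<union> {x, y}"] A[of k] by (meson finite.emptyI finite_insert finite_UnI)
      have "near (A k) (n k) g" by (rule near_mono[OF g(2)]) auto
      then have hg: "N (h k - g) \<le> \<delta> k"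
        by (intro close h g)
      have "near {x, y} k g" by (rule near_mono[OF g(2)]) auto
      then have gf: "\<bar>g x - f x\<bar> < 1 / Suc k" "\<bar>g y - f y\<bar> < 1 / Suc k"
        by (simp_all add: near_def)
      have *: "r * N u \<le> \<bar>r\<bar> * N u" for u
        by (intro mult_right_mono root_nonneg) simp
      have "\<bar>(h k - l) x - (h k - l) y\<bar> \<le> \<bar>r\<bar> * N (h k - l)"
        using r[OF diff_in_domain[OF h(1) l], of k] *[of "h k - l"] by linarith
      moreover have "\<bar>(h k - g) x - (h k - g) y\<bar> \<le> \<bar>r\<bar> * \<delta> k"
        using r[OF diff_in_domain[OF h(1) g(1)], of k] *[of "h k - g"]
          mult_left_mono[OF hg, of "\<bar>r\<bar>"] by linarith
      ultimately show ?thesis using gf by simp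
    qed
    have "(\<lambda>k. \<bar>r\<bar> * N (h k - l) + \<bar>r\<bar> * \<delta> k + 2 * (1 / Suc k)) \<longlonglongrightarrow> \<bar>r\<bar> * 0 + \<bar>r\<bar> * 0 + 2 * 0"
      by (intro tendsto_add tendsto_mult_left lim \<delta> eps)
    then have "\<bar>(l x - l y) - (f x - f y)\<bar> \<le> \<bar>r\<bar> * 0 + \<bar>r\<bar> * 0 + 2 * 0"
      by (rule LIMSEQ_le_const) (use bound in blast)
    then show ?thesis by simp
  qed
  \<comment> \<open>\<open>undefined\<close> serves as an arbitrary base point.\<close>
  have "f - l = (\<lambda>_. f undefined - l undefined)"
  proof
    show "(f - l) x = f undefined - l undefined" for x
      using diff[of x undefined] by simp
  qed
  then have "f - l \<in> const_funs" by (auto simp: const_funs_def)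
  then have f: "f \<in> D" "N f = N l" using root_cong_const[OF l] by auto
  have "N l \<le> M + 1 / Suc k + N (h k - l)" for k
    using root_add[of "h k" "l - h k"] h[of k] l root_diff_commute[of "h k" l]
    by (simp add: diff_in_domain)
  moreover have "(\<lambda>k. M + 1 / Suc k + N (h k - l)) \<longlonglongrightarrow> M + 0 + 0"
    by (intro tendsto_add tendsto_const lim eps)
  ultimately have "N l \<le> M + 0 + 0"
    by (intro LIMSEQ_le_const) auto
  then show ?thesis using f \<open>M \<le> L\<close> by simp
qed

text \<open>If \<open>y < E f\<close> but \<open>y < E g\<close> does not hold eventually, then
  every basic neighbourhood of \<open>f\<close> contains some \<open>g\<close> with
  \<open>E g \<le> y\<close>, contradicting closedness of the sublevel set.\<close>

lemma lsc: "lsc_pointwise E"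
  unfolding lsc_pointwise_def
proof (intro allI impI)
  fix F and f :: "'a \<Rightarrow> real"
  assume lim: "\<forall>x. ((\<lambda>g. g x) \<longlongrightarrow> f x) F"
  show "E f \<le> Liminf F E"
    unfolding le_Liminf_iff
  proof (intro allI impI, rule ccontr)
    fix y assume y: "y < E f" "\<not> eventually (\<lambda>g. y < E g) F"
    then have "y < \<infinity>" by (auto intro: less_le_trans)
    then obtain b where b: "y = ennreal b" "0 \<le> b" by (cases y) auto
    \<comment> \<open>The level \<open>y\<close> expressed for the energy root.\<close>
    define L where "L = b powr (1 / p)"
    have yL: "y = ennreal (L powr p)" using b p_gt_1 by (simp add: L_def powr_powr)
    have "\<exists>h\<in>D. (\<forall>x\<in>A. \<bar>h x - f x\<bar> < 1 / Suc n) \<and> N h \<le> L" if "finite A" for A n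
    proof -
      have "eventually (\<lambda>g. \<bar>g x - f x\<bar> < 1 / Suc n) F" for x
        using tendstoD[OF lim[rule_format, of x], of "1 / Suc n"] by (simp add: dist_real_def)
      then have ev: "eventually (\<lambda>g. \<forall>x\<in>A. \<bar>g x - f x\<bar> < 1 / Suc n) F"
        using that by (simp add: eventually_ball_finite)
      have "\<exists>g. (\<forall>x\<in>A. \<bar>g x - f x\<bar> < 1 / Suc n) \<and> E g \<le> y"
      proof (rule ccontr)
        assume "\<nexists>g. (\<forall>x\<in>A. \<bar>g x - f x\<bar> < 1 / Suc n) \<and> E g \<le> y"
        then have "eventually (\<lambda>g. y < E g) F"
          by (intro eventually_mono[OF ev]) (auto simp: not_le)
        with y show False by blast
      qed
      then obtain g where g: "\<forall>x\<in>A. \<bar>g x - f x\<bar> < 1 / Suc n" "E g \<le> y" by blast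
      moreover have "g \<in> D" using g(2) in_domain_if_le unfolding yL by blast
      ultimately show ?thesis
        using energy_le_iff[of g L] by (auto simp: yL L_def)
    qed
    then have "f \<in> D \<and> N f \<le> L" by (rule sublevel_closed)
    then have "E f \<le> y" using energy_le_iff[of f L] by (simp add: yL L_def)
    with y(1) show False by simp
  qed
qed

end

theorem proposition5p11:
  fixes p :: real and E :: "('a \<Rightarrow> real) \<Rightarrow> ennreal"
  assumes "1 < p" and "p_resistance_form p E"
  shows "nonlinear_resistance_form E"
proof -
  interpret p_resistance p E by unfold_locales (use assms in auto)
  have "E 0 = 0"
    using assms(2) by (auto simp: p_resistance_form_def energy_kernel_def const_funs_def zero_fun_def)
  moreover have "\<forall>x y. resistance E x y < \<infinity>"
    using assms(2) by (simp add: p_resistance_form_def)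
  ultimately show ?thesis
    unfolding nonlinear_resistance_form_def
    using convex lsc normal_contractions by blast
qed

end
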